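(* Let $L>0$ and $m\ge 1$. Let $a\in L^\infty(0,L)$ be such that there exist constants $0<\alpha<\beta$ with $\alpha\le a(x)\le\beta$ for a.e. $x\in(0,L)$, and let $g\in L^m(0,L)$. Let $\phi:\mathbb{R}\to\mathbb{R}\cup\{+\infty\}$ be continuous with values in $\mathbb{R}\cup\{+\infty\}$, with $\phi(s)<+\infty$ for every $s\neq 0$ and $\phi(0)=+\infty$. If there exists a constant $M>0$ such that $$g(x)\ge -M\quad\text{for a.e. }x\in(0,L),$$ then there does not exist any weak solution of the problem $$-\frac{d}{dx}\left(a(x)\frac{du}{dx}\right)=-\frac{d\phi(u)}{dx}-\frac{dg(x)}{dx}\ \text{ in }(0,L),\qquad u(0)=u(L)=0,$$ for the data $(a,g,\phi)$, neither in the sense of Definition $1$ if $m=1$, nor in the sense of Definition $m$ if $m>1$.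
   Context: $\mathbb{R}\cup\{+\infty\}$ carries its usual topology (neighbourhoods of $+\infty$ contain some $(M,+\infty]$). Elements of $W^{1,1}_0(0,L)$ are identified with their continuous representatives on $[0,L]$, and $\phi(u)$ denotes the function $x\mapsto\phi(u(x))$. Weak solution in the sense of Definition $1$ (for $m=1$): a function $u$ such that $u\in W^{1,1}_0(0,L)$, $\phi(u)\in L^1(0,L)$, and $$\int_0^L a(x)\frac{du}{dx}\frac{dz}{dx}\,dx=\int_0^L\phi(u)\frac{dz}{dx}\,dx+\int_0^L g(x)\frac{dz}{dx}\,dx$$ for every Lipschitz function $z$ on $(0,L)$ with $z(0)=z(L)=0$. Weak solution in the sense of Definition $m$ (for $m>1$): a function $u$ such that $u\in W^{1,m}_0(0,L)$, $\phi(u)\in L^m(0,L)$, and the same identity holds for every $z\in W^{1,m'}_0(0,L)$, where $m'=\frac{m}{m-1}$. *)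

theory Defs
  imports "HOL-Analysis.Analysis"
begin

abbreviation leb :: "real \<Rightarrow> real measure" where
  "leb L \<equiv> lebesgue_on {0<..<L}"

definition Lp :: "real \<Rightarrow> real \<Rightarrow> (real \<Rightarrow> real) set" where
  "Lp L p = {f. f \<in> borel_measurable (leb L) \<and> integrable (leb L) (\<lambda>x. \<bar>f x\<bar> powr p)}"

definition Lp_norm :: "real \<Rightarrow> real \<Rightarrow> (real \<Rightarrow> real) \<Rightarrow> real" where
  "Lp_norm L p f = (LINT x|leb L. \<bar>f x\<bar> powr p) powr (1 / p)"

definition Linf :: "real \<Rightarrow> (real \<Rightarrow> real) set" where
  "Linf L = {f. f \<in> borel_measurable (leb L) \<and> (\<exists>C. AE x in leb L. \<bar>f x\<bar> \<le> C)}"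

text \<open>An extended-real-valued function belongs to \<open>L\<^sup>p\<close> if it is finite almost everywhere and
  its image under \<open>real_of_ereal\<close> does. The finiteness clause is essential, since
  \<open>real_of_ereal \<infinity> = 0\<close>.\<close>

definition Lp_ereal :: "real \<Rightarrow> real \<Rightarrow> (real \<Rightarrow> ereal) set" where
  "Lp_ereal L p =
     {f. (AE x in leb L. \<bar>f x\<bar> \<noteq> \<infinity>) \<and> (\<lambda>x. real_of_ereal (f x)) \<in> Lp L p}"

definition L1_loc :: "real \<Rightarrow> (real \<Rightarrow> real) set" where
  "L1_loc L = {f. \<forall>K. compact K \<longrightarrow> K \<subseteq> {0<..<L} \<longrightarrow> integrable (lebesgue_on K) f}"

text \<open>Sobolev spaces on an interval follow Brezis, Functional Analysis, Sobolev Spaces and Partial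
  Differential Equations, Chapter 8: the test functions are \<open>C\<^sup>1\<close> with compact support in \<open>(0, L)\<close>,
  extended by zero to the real line, and \<open>W\<^sub>0\<close> is the closure of the test functions
  in the Sobolev norm.\<close>

definition C1c :: "real \<Rightarrow> (real \<Rightarrow> real) set" where
  "C1c L = {\<psi>. \<psi> C1_differentiable_on UNIV \<and> closure {x. \<psi> x \<noteq> 0} \<subseteq> {0<..<L}}"

definition has_weak_derivative :: "real \<Rightarrow> (real \<Rightarrow> real) \<Rightarrow> (real \<Rightarrow> real) \<Rightarrow> bool" where
  "has_weak_derivative L u du \<longleftrightarrow>
     u \<in> L1_loc L \<and> du \<in> L1_loc L \<and>
     (\<forall>\<psi> \<in> C1c L. (LINT x|leb L. u x * deriv \<psi> x) = - (LINT x|leb L. du x * \<psi> x))"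

text \<open>Each class in \<open>W\<^sub>0\<close> is represented by its continuous representative on \<open>[0, L]\<close>;
  values outside \<open>[0, L]\<close> are irrelevant.\<close>

definition W1p0 :: "real \<Rightarrow> real \<Rightarrow> (real \<Rightarrow> real) set" where
  "W1p0 L p =
     {u. continuous_on {0..L} u \<and> u \<in> Lp L p \<and>
         (\<exists>du \<in> Lp L p. has_weak_derivative L u du \<and>
            (\<forall>\<epsilon> > 0. \<exists>\<psi> \<in> C1c L.
               Lp_norm L p (\<lambda>x. u x - \<psi> x) + Lp_norm L p (\<lambda>x. du x - deriv \<psi> x) < \<epsilon>))}"

definition weak_identity ::
  "real \<Rightarrow> (real \<Rightarrow> real) \<Rightarrow> (real \<Rightarrow> real) \<Rightarrow> (real \<Rightarrow> ereal) \<Rightarrow>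
   (real \<Rightarrow> real) \<Rightarrow> (real \<Rightarrow> real) \<Rightarrow> (real \<Rightarrow> real) \<Rightarrow> bool" where
  "weak_identity L a g \<phi> u du dz \<longleftrightarrow>
     (LINT x|leb L. a x * du x * dz x) =
     (LINT x|leb L. real_of_ereal (\<phi> (u x)) * dz x) + (LINT x|leb L. g x * dz x)"

text \<open>Weak derivatives are unique up to null sets, so neither the choice of \<open>du\<close> nor that
  of \<open>dz\<close> below matters.\<close>

definition weak_solution_1 ::
  "real \<Rightarrow> (real \<Rightarrow> real) \<Rightarrow> (real \<Rightarrow> real) \<Rightarrow> (real \<Rightarrow> ereal) \<Rightarrow> (real \<Rightarrow> real) \<Rightarrow> bool" where
  "weak_solution_1 L a g \<phi> u \<longleftrightarrow>
     u \<in> W1p0 L 1 \<and> (\<lambda>x. \<phi> (u x)) \<in> Lp_ereal L 1 \<and>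
     (\<exists>du. has_weak_derivative L u du \<and>
        (\<forall>z dz. (\<exists>C. C-lipschitz_on {0..L} z) \<longrightarrow> z 0 = 0 \<longrightarrow> z L = 0 \<longrightarrow>
           has_weak_derivative L z dz \<longrightarrow> weak_identity L a g \<phi> u du dz))"

definition weak_solution_m ::
  "real \<Rightarrow> real \<Rightarrow> (real \<Rightarrow> real) \<Rightarrow> (real \<Rightarrow> real) \<Rightarrow> (real \<Rightarrow> ereal) \<Rightarrow> (real \<Rightarrow> real) \<Rightarrow> bool" where
  "weak_solution_m L m a g \<phi> u \<longleftrightarrow>
     u \<in> W1p0 L m \<and> (\<lambda>x. \<phi> (u x)) \<in> Lp_ereal L m \<and>
     (\<exists>du. has_weak_derivative L u du \<and>
        (\<forall>z \<in> W1p0 L (m / (m - 1)). \<forall>dz.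
           has_weak_derivative L z dz \<longrightarrow> weak_identity L a g \<phi> u du dz))"

end

theory Submission
  imports Defs
begin

text \<open>
  Testing with \<open>C\<^sup>1\<close> functions of compact support already forces, by du Bois-Reymond,
  \<open>a u' = \<phi>(u) + g + c\<close> almost everywhere for some constant \<open>c\<close>. Where \<open>u\<close> is close to \<open>0\<close>,
  \<open>\<phi>(u)\<close> exceeds \<open>M - c + 1\<close>, so that \<open>u' \<ge> 1 / \<beta>\<close>: the function \<open>u\<close> increases strictly whenever
  its values are small. Hence \<open>u\<close> is positive just after each of its zeros in \<open>[0, L)\<close> and
  negative just before \<open>L\<close>. The zeros in \<open>[0, L)\<close> form a nonempty compact set, and between
  the last of them and \<open>L\<close> the intermediate value theorem yields another one.
\<close>

subsection \<open>Test functions and the fundamental lemma\<close>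

text \<open>A Dynkin argument: the sets over which \<open>h\<close> integrates to zero are closed
  under complements and disjoint unions, and the open intervals form an intersection-stable
  generator of the Borel sets. Lebesgue sets differ from Borel sets by null sets, and a density with
  all set integrals zero vanishes almost everywhere.\<close>

lemma AE_zero_if_integral_intervals_zero:
  fixes h :: "real \<Rightarrow> real"
  assumes h: "integrable lebesgue h"
    and z: "\<And>a b. (LINT x|lebesgue. indicator {a<..<b} x * h x) = 0"
  shows "AE x in lebesgue. h x = 0"
proof -
  have int: "integrable lebesgue (\<lambda>x. indicator A x * h x)" if "A \<in> sets lebesgue" for A
    using integrable_mult_indicator[OF that h] by simp
  have lim: "(\<lambda>n. LINT x|lebesgue. indicator (A n) x * h x) \<longlonglongrightarrow> (LINT x|lebesgue. indicator (\<Union>n. A n) x * h x)"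
    if "\<And>n. A n \<in> sets lebesgue" "incseq A" for A :: "nat \<Rightarrow> real set"
  proof (rule integral_dominated_convergence[where w = "\<lambda>x. \<bar>h x\<bar>"])
    show "AE x in lebesgue. (\<lambda>n. indicator (A n) x * h x) \<longlonglongrightarrow> indicator (\<Union>n. A n) x * h x"
      by (intro AE_I2 tendsto_mult tendsto_const LIMSEQ_indicator_incseq that(2))
    show "AE x in lebesgue. norm (indicator (A n) x * h x) \<le> \<bar>h x\<bar>" for n
      by (intro AE_I2) (simp add: indicator_def)
    show "(\<lambda>x. indicator (A n) x * h x) \<in> borel_measurable lebesgue" for n
      using int[OF that(1)] by (rule borel_measurable_integrable)
    show "(\<lambda>x. indicator (\<Union>n. A n) x * h x) \<in> borel_measurable lebesgue"
      using that(1) by (intro borel_measurable_integrable int) auto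
    show "integrable lebesgue (\<lambda>x. \<bar>h x\<bar>)" using h by simp
  qed
  \<comment> \<open>Needed for complements: exhaust the line by the intervals (-n, n).\<close>
  have total: "(LINT x|lebesgue. h x) = 0"
  proof -
    have "\<exists>n. - real n < x \<and> x < real n" for x
      using reals_Archimedean2[of "\<bar>x\<bar>"] by (metis abs_less_iff minus_less_iff)
    then have "(\<Union>n. {- real n<..<real n}) = UNIV" by auto
    moreover have "incseq (\<lambda>n. {- real n<..<real n})" by (auto simp: incseq_def)
    ultimately show ?thesis using lim[of "\<lambda>n. {- real n<..<real n}"] by (simp add: z LIMSEQ_const_iff)
  qed
  have borel: "(LINT x|lebesgue. indicator A x * h x) = 0" if "A \<in> sets borel" for A
  proof -
    have sb: "sigma_sets UNIV (range (\<lambda>(a, b). box a b)) = sets (borel :: real measure)"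
      by (simp add: borel_eq_box)
    have stable: "Int_stable (range (\<lambda>(a, b). box a b :: real set))"
      by (rule Int_stableI_image) (auto simp: box_Int_box box_real split: prod.splits)
    have "range (\<lambda>(a, b). box a b :: real set) \<subseteq> Pow UNIV" by simp
    moreover have "A \<in> sigma_sets UNIV (range (\<lambda>(a, b). box a b))"
      using that sb by simp
    ultimately show ?thesis
    proof (induction rule: sigma_sets_induct_disjoint[OF stable, consumes 2, case_names basic empty compl union])
      case (union A)
      then have m: "A i \<in> sets lebesgue" for i
        using range_subsetD[OF union(2), of i] unfolding sb by simp
      \<comment> \<open>The countable disjoint union is the limit of its finite partial unions,
        whose integrals vanish by additivity.\<close>
      have "(\<lambda>i. LINT x|lebesgue. indicator (\<Union>j<i. A j) x * h x) \<longlonglongrightarrow> (LINT x|lebesgue. indicator (\<Union>i. \<Union>j<i. A j) x * h x)"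
      proof (rule lim)
        show "(\<Union>j<i. A j) \<in> sets lebesgue" for i using m by auto
        show "incseq (\<lambda>i. \<Union>j<i. A j)" by (intro monoI UN_mono) auto
      qed
      moreover have "(\<Union>i. \<Union>j<i. A j) = (\<Union>i. A i)" by blast
      moreover have "(LINT x|lebesgue. indicator (\<Union>j<i. A j) x * h x) = 0" for i
      proof (induction i)
        case (Suc i)
        have "A i \<inter> A j = {}" if "j < i" for j
          using union(1) that by (simp add: disjoint_family_on_def)
        then have "A i \<inter> (\<Union>j<i. A j) = {}" by blast
        then have "indicator (\<Union>j<Suc i. A j) x * h x = indicator (\<Union>j<i. A j) x * h x + indicator (A i) x * h x" for x
          by (simp add: lessThan_Suc indicator_def disjoint_iff)
        moreover have "integrable lebesgue (\<lambda>x. indicator (\<Union>j<i. A j) x * h x)"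
          by (rule int) (use m in auto)
        ultimately show ?case
          using Suc union(3)[of i] int[OF m[of i]] by (simp only: Bochner_Integration.integral_add)
      qed auto
      ultimately show ?case by (simp add: LIMSEQ_const_iff)
    next
      case (compl A)
      then have m: "A \<in> sets lebesgue"
        unfolding sb by simp
      have "indicator (UNIV - A) x * h x = h x - indicator A x * h x" for x
        by (simp add: indicator_def)
      then show ?case using compl total int[OF m] h by (simp add: Bochner_Integration.integral_diff)
    next
      case (basic A)
      then show ?case using z by (auto simp: box_real)
    qed auto
  qed
  show ?thesis
  proof (rule density_unique_real[where f'="\<lambda>_. 0"])
    fix A :: "real set" assume A0: "A \<in> sets lebesgue"
    \<comment> \<open>Replace the Lebesgue set by its Borel part \<open>S\<close>; the remainder
      \<open>N\<close> does not affect integrals.\<close>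
    then obtain S N N' where A: "A = S \<union> N" "N \<subseteq> N'" "N' \<in> null_sets lborel" "S \<in> sets lborel"
      by (rule sets_completionE)
    have "AE x in lebesgue. x \<notin> N'" using A(3) by (intro AE_not_in null_sets_completionI)
    then have ae: "AE x in lebesgue. indicator A x * h x = indicator S x * h x"
      by eventually_elim (use A(1,2) in \<open>auto simp add: indicator_def\<close>)
    have "(LINT x|lebesgue. indicator A x * h x) = (LINT x|lebesgue. indicator S x * h x)"
      using A(4) by (intro integral_cong_AE borel_measurable_integrable int A0 ae) simp
    then show "set_lebesgue_integral lebesgue A h = (\<integral>x\<in>A. 0 \<partial>lebesgue)"
      using borel A(4) by (simp add: set_lebesgue_integral_def)
  qed (use h in auto)
qed

section \<open>Test functions and explicit bumps\<close>

lemma C1cI: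
  assumes D: "\<And>t. (\<psi> has_real_derivative D t) (at t)" and cont: "continuous_on UNIV D"
    and supp: "\<And>t. t \<notin> {x..y} \<Longrightarrow> \<psi> t = 0" and xy: "0 < x" "y < L"
  shows "\<psi> \<in> C1c L" "deriv \<psi> = D"
proof -
  show "deriv \<psi> = D" using DERIV_imp_deriv[OF D] by auto
  have "\<psi> C1_differentiable_on UNIV"
    unfolding C1_differentiable_on_def
    using D cont by (auto simp: has_real_derivative_iff_has_vector_derivative)
  moreover have "closure {t. \<psi> t \<noteq> 0} \<subseteq> {x..y}"
    using supp by (intro closure_minimal closed_atLeastAtMost) (metis (mono_tags) mem_Collect_eq subsetI)
  ultimately show "\<psi> \<in> C1c L" using xy by (auto simp: C1c_def)
qed

lemma
  assumes "\<psi> \<in> C1c L"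
  shows C1c_has_derivative: "(\<psi> has_real_derivative deriv \<psi> t) (at t)"
    and C1c_continuous_deriv: "continuous_on S (deriv \<psi>)"
    and C1c_continuous: "continuous_on S \<psi>"
    and C1c_outside: "t \<notin> {0<..<L} \<Longrightarrow> \<psi> t = 0"
proof -
  obtain D where D: "\<And>t. (\<psi> has_real_derivative D t) (at t)" and c: "continuous_on UNIV D"
    using assms unfolding C1c_def C1_differentiable_on_def
    by (auto simp: has_real_derivative_iff_has_vector_derivative)
  have e: "deriv \<psi> = D" using DERIV_imp_deriv[OF D] by auto
  show "(\<psi> has_real_derivative deriv \<psi> t) (at t)" using D e by simp
  show "continuous_on S (deriv \<psi>)" using c e continuous_on_subset by blast
  show "continuous_on S \<psi>" using D DERIV_continuous_on has_field_derivative_at_within by blast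
  show "\<psi> t = 0" if "t \<notin> {0<..<L}"
    using assms that closure_subset[of "{t. \<psi> t \<noteq> 0}"] unfolding C1c_def by blast
qed

text \<open>The support is a compact subset of the open interval, so its least and greatest points
  stay away from 0 and \<open>L\<close>. Off the closed support \<psi> vanishes on a whole
  neighbourhood, hence so does its derivative.\<close>

lemma C1c_supportE:
  assumes "\<psi> \<in> C1c L" "L > 0"
  obtains x y where "0 < x" "x \<le> y" "y < L" "\<And>t. t \<notin> {x..y} \<Longrightarrow> \<psi> t = 0 \<and> deriv \<psi> t = 0"
proof -
  define K where "K = closure {t. \<psi> t \<noteq> 0}"
  have K: "K \<subseteq> {0<..<L}" "closed K" using assms by (auto simp: C1c_def K_def)
  have "bounded K" by (rule bounded_subset[OF bounded_closed_interval[of 0 L]]) (use K(1) in auto)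
  then have cK: "compact K" using K by (simp add: compact_eq_bounded_closed)
  obtain x y where xy: "0 < x" "x \<le> y" "y < L" "K \<subseteq> {x..y}"
  proof (cases "K = {}")
    \<comment> \<open>For \<psi> = 0 any interval inside (0, \<open>L\<close>) will do; the midpoint
      serves as a degenerate one.\<close>
    case True then show ?thesis using that[of "L/2" "L/2"] assms by auto
  next
    case False
    obtain a b where "a \<in> K" "\<And>t. t \<in> K \<Longrightarrow> a \<le> t" "b \<in> K" "\<And>t. t \<in> K \<Longrightarrow> t \<le> b"
      using compact_attains_inf[OF cK False] compact_attains_sup[OF cK False] by metis
    then show ?thesis using K that[of a b] by (metis subsetD greaterThanLessThan_iff atLeastAtMost_iff subsetI)
  qed
  show ?thesis
  proof (rule that[OF xy(1-3)])
    fix t assume t: "t \<notin> {x..y}"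
    then have "t \<in> - K" using xy by auto
    have z: "\<psi> s = 0" if "s \<in> - K" for s using that closure_subset[of "{t. \<psi> t \<noteq> 0}"] by (auto simp: K_def)
    have "((\<lambda>_. 0) has_real_derivative 0) (at t)" by simp
    then have "(\<psi> has_real_derivative 0) (at t)"
      by (rule has_field_derivative_transform_within_open[where S="- K"])
        (use z \<open>t \<in> - K\<close> K(2) in auto)
    then show "\<psi> t = 0 \<and> deriv \<psi> t = 0" using z[OF \<open>t \<in> - K\<close>] DERIV_imp_deriv by blast
  qed
qed

text \<open>Squaring the positive parts makes the product continuously differentiable across
  \<open>x\<close> and \<open>y\<close>. For \<open>x\<close> \<ge> \<open>y\<close> the function is
  identically zero.\<close>

definition bump :: "real \<Rightarrow> real \<Rightarrow> real \<Rightarrow> real" where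
  "bump x y t = (max 0 (t - x))\<^sup>2 * (max 0 (y - t))\<^sup>2"

lemma has_real_derivative_max_sq: "((\<lambda>s::real. (max 0 s)\<^sup>2) has_real_derivative 2 * max 0 s) (at s)"
proof -
  consider "s < 0" | "s > 0" | "s = 0" by linarith
  then show ?thesis
  proof cases
    case 1
    have "((\<lambda>s::real. 0) has_real_derivative 2 * max 0 s) (at s)" using 1 by simp
    then show ?thesis
      by (rule has_field_derivative_transform_within_open[where S="{..<0}"]) (use 1 in auto)
  next
    case 2
    have "((\<lambda>s::real. s\<^sup>2) has_real_derivative 2 * max 0 s) (at s)"
      using 2 by (auto intro!: derivative_eq_intros)
    then show ?thesis
      by (rule has_field_derivative_transform_within_open[where S="{0<..}"]) (use 2 in auto)
  next
    case 3
    \<comment> \<open>At the kink the difference quotient is squeezed between 0 and the absolute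
      value of \<open>h\<close>.\<close>
    have "((\<lambda>h::real. ((max 0 h)\<^sup>2 - 0) / h) \<longlongrightarrow> 0) (at 0)"
    proof (rule tendsto_sandwich[where f="\<lambda>_. 0" and h="\<lambda>h. \<bar>h\<bar>"])
      show "((\<lambda>h::real. \<bar>h\<bar>) \<longlongrightarrow> 0) (at 0)" by (intro tendsto_rabs_zero tendsto_ident_at)
      have "0 \<le> ((max 0 h)\<^sup>2 - 0) / h" "((max 0 h)\<^sup>2 - 0) / h \<le> \<bar>h\<bar>" for h :: real
        by (auto simp: max_def power2_eq_square)
      then show "\<forall>\<^sub>F h::real in at 0. 0 \<le> ((max 0 h)\<^sup>2 - 0) / h"
         "\<forall>\<^sub>F h::real in at 0. ((max 0 h)\<^sup>2 - 0) / h \<le> \<bar>h\<bar>" by auto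
    qed auto
    then show ?thesis using 3 by (simp add: DERIV_def)
  qed
qed

lemma bump_nonneg: "0 \<le> bump x y t"
  by (simp add: bump_def)

lemma bump_pos_iff: "0 < bump x y t \<longleftrightarrow> t \<in> {x<..<y}"
  by (auto simp: bump_def max_def zero_less_mult_iff)

lemma bump_eq_0: "t \<notin> {x<..<y} \<Longrightarrow> bump x y t = 0"
  by (auto simp: bump_def max_def)

text \<open>Multiplied by \<open>k\<close>, these quotients converge boundedly to the indicator of \<open>(x, y)\<close> as
  \<open>k \<rightarrow> \<infinity>\<close>.\<close>

lemma bump_quotient_in_C1c:
  assumes "0 < x" "y < L" "k \<ge> 0"
  shows "(\<lambda>t. bump x y t / (1 + k * bump x y t)) \<in> C1c L"
proof -
  define D where "D t = 2 * max 0 (t - x) * (max 0 (y - t))\<^sup>2 - (max 0 (t - x))\<^sup>2 * (2 * max 0 (y - t))" for t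
  have "((\<lambda>t. (max 0 (t - x))\<^sup>2) has_real_derivative 2 * max 0 (t - x) * 1) (at t)" for t
    by (rule DERIV_chain2[OF has_real_derivative_max_sq]) (auto intro!: derivative_eq_intros)
  moreover have "((\<lambda>t. (max 0 (y - t))\<^sup>2) has_real_derivative 2 * max 0 (y - t) * (-1)) (at t)" for t
    by (rule DERIV_chain2[OF has_real_derivative_max_sq]) (auto intro!: derivative_eq_intros)
  ultimately have b: "(bump x y has_real_derivative D t) (at t)" for t
    using DERIV_mult[of "\<lambda>t. (max 0 (t - x))\<^sup>2" "2 * max 0 (t - x) * 1" t UNIV
        "\<lambda>t. (max 0 (y - t))\<^sup>2" "2 * max 0 (y - t) * (-1)"]
    by (simp add: bump_def[abs_def] D_def algebra_simps)
  have bc: "continuous_on UNIV (bump x y)" using b DERIV_continuous_on has_field_derivative_at_within by blast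
  have nz: "1 + k * bump x y t > 0" for t using bump_nonneg[of x y t] assms(3)
    by (simp add: add_pos_nonneg)
  \<comment> \<open>In the quotient rule the two terms containing \<open>k\<close> cancel, leaving
    only \<open>D t\<close> in the numerator.\<close>
  have q: "((\<lambda>t. bump x y t / (1 + k * bump x y t)) has_real_derivative D t / (1 + k * bump x y t)\<^sup>2) (at t)" for t
    using nz[of t] by (auto intro!: derivative_eq_intros b simp: field_simps power2_eq_square)
  show ?thesis
  proof (rule C1cI(1)[OF q _ _ assms(1,2)])
    show "continuous_on UNIV (\<lambda>t. D t / (1 + k * bump x y t)\<^sup>2)"
      unfolding D_def by (intro continuous_intros bc) (use nz in \<open>auto simp: less_le\<close>)
  qed (auto simp: bump_eq_0)
qed

section \<open>Integrability on the interval\<close>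

lemma integrable_lebesgue_on_iff:
  fixes f :: "real \<Rightarrow> real"
  assumes "S \<in> sets lebesgue"
  shows "integrable (lebesgue_on S) f \<longleftrightarrow> f absolutely_integrable_on S"
  using assms by (simp add: set_integrable_def integrable_restrict_space)

lemma integrable_leb_iff_closed:
  fixes f :: "real \<Rightarrow> real"
  shows "integrable (leb L) f \<longleftrightarrow> f absolutely_integrable_on {0..L}"
  using absolutely_integrable_on_open_interval[where f=f and a=0 and b=L]
  by (simp add: integrable_lebesgue_on_iff box_real)

lemma continuous_integrable_leb:
  fixes f :: "real \<Rightarrow> real"
  assumes "continuous_on {0..L} f"
  shows "integrable (leb L) f" "(LINT x|leb L. f x) = integral {0..L} f"
proof -
  show i: "integrable (leb L) f"
    using assms absolutely_integrable_continuous_real integrable_leb_iff_closed by blast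
  show "(LINT x|leb L. f x) = integral {0..L} f"
    using lebesgue_integral_eq_integral[OF i] by (simp add: integral_open_interval_real)
qed

text \<open>Local integrability suffices here because the product lives on the compact interval
  [\<open>x\<close>, \<open>y\<close>], where \<xi> is bounded.\<close>

lemma L1_loc_mult_integrable:
  assumes f: "f \<in> L1_loc L" and cont: "continuous_on UNIV \<xi>"
    and xy: "0 < x" "y < L" and supp: "\<And>t. t \<notin> {x..y} \<Longrightarrow> \<xi> t = 0"
  shows "integrable (leb L) (\<lambda>t. f t * \<xi> t)"
proof -
  have "integrable (lebesgue_on {x..y}) f" using f xy by (simp add: L1_loc_def subset_iff)
  then have "f absolutely_integrable_on {x..y}" by (simp add: integrable_lebesgue_on_iff)
  moreover have "continuous_on {x..y} \<xi>" using cont continuous_on_subset by blast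
  ultimately have "(\<lambda>t. \<xi> t * f t) absolutely_integrable_on {x..y}"
    by (intro absolutely_integrable_bounded_measurable_product_real compact_imp_bounded
        compact_continuous_image continuous_imp_measurable_on_sets_lebesgue) auto
  then have "integrable lebesgue (\<lambda>t. indicator {x..y} t * (\<xi> t * f t))" by (simp add: set_integrable_def)
  moreover have "indicator {x..y} t * (\<xi> t * f t) = indicator {0<..<L} t * (f t * \<xi> t)" for t
    using supp[of t] xy by (auto simp: indicator_def)
  ultimately show ?thesis by (simp add: integrable_restrict_space)
qed

lemma tendsto_bump_quotient:
  fixes p :: real assumes "p > 0"
  shows "(\<lambda>n. real n * (p / (1 + real n * p))) \<longlonglongrightarrow> 1"
proof -
  have "filterlim (\<lambda>n. 1 + real n * p) at_top sequentially"
    by (intro filterlim_tendsto_add_at_top[OF tendsto_const] filterlim_at_top_mult_tendsto_pos[OF tendsto_const assms] filterlim_real_sequentially)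
  then have "(\<lambda>n. 1 - 1 / (1 + real n * p)) \<longlonglongrightarrow> 1 - 0"
    by (intro tendsto_diff tendsto_const real_tendsto_divide_at_top[OF tendsto_const[of 1]])
  moreover have "1 - 1 / (1 + q) = q / (1 + q)" if "q \<ge> 0" for q :: real
    using that by (simp add: field_simps)
  then have "1 - 1 / (1 + real n * p) = real n * (p / (1 + real n * p))" for n
    using assms by simp
  ultimately show ?thesis by simp
qed

text \<open>Indicators of intervals are bounded pointwise limits of test functions, so dominated
  convergence gives vanishing integrals of \<open>f\<close> over intervals compactly inside (0,
  \<open>L\<close>). The measure-theoretic lemma then applies on each of countably many subintervals
  exhausting (0, \<open>L\<close>).\<close>

lemma fundamental_lemma_variations:
  assumes L: "L > 0" and f: "f \<in> L1_loc L"
    and z: "\<And>\<psi>. \<psi> \<in> C1c L \<Longrightarrow> (LINT x|leb L. f x * \<psi> x) = 0"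
  shows "AE x in leb L. f x = 0"
proof -
  have key: "AE t in lebesgue. t \<in> {c<..<d} \<longrightarrow> f t = 0" if cd: "0 < c" "d < L" for c d
  proof -
    \<comment> \<open>Truncation turns the locally integrable \<open>f\<close> into a function
      integrable on the whole line.\<close>
    define h where "h t = indicator {c<..<d} t * f t" for t
    have "integrable (lebesgue_on {c..d}) f" using f cd by (simp add: L1_loc_def subset_iff)
    then have "f absolutely_integrable_on {c..d}" by (simp add: integrable_lebesgue_on_iff)
    then have "f absolutely_integrable_on {c<..<d}" by (rule set_integrable_subset) auto
    then have h: "integrable lebesgue h" by (simp add: set_integrable_def h_def[abs_def])
    have "(LINT t|lebesgue. indicator {a<..<b} t * h t) = 0" for a b
    proof -
      \<comment> \<open>(\<open>x\<close>, \<open>y\<close>) is the intersection of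
        (\<open>a\<close>, \<open>b\<close>) and (\<open>c\<close>, \<open>d\<close>). It may be
        empty, in which case the bump is zero.\<close>
      define x y where "x = max a c" and "y = min b d"
      define q where "q n t = bump x y t / (1 + real n * bump x y t)" for n :: nat and t
      have xy: "0 < x" "y < L" using cd by (auto simp: x_def y_def)
      have q: "q n \<in> C1c L" for n unfolding q_def[abs_def] by (rule bump_quotient_in_C1c[OF xy]) simp
      \<comment> \<open>The test function vanishes outside (\<open>c\<close>, \<open>d\<close>), so
        the truncation is invisible to it.\<close>
      have eq: "h t * (real n * q n t) = real n * (indicator {0<..<L} t * (f t * q n t))" for n t
        using bump_eq_0[of t x y] cd by (auto simp: h_def q_def x_def y_def indicator_def)
      have zero: "(LINT t|lebesgue. h t * (real n * q n t)) = 0" for n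
        using z[OF q[of n]] unfolding eq by (simp add: integral_restrict_space)
      have "(\<lambda>n. LINT t|lebesgue. h t * (real n * q n t)) \<longlonglongrightarrow> (LINT t|lebesgue. indicator {a<..<b} t * h t)"
      proof (rule integral_dominated_convergence[where w = "\<lambda>t. \<bar>h t\<bar>"])
        show "(\<lambda>t. h t * (real n * q n t)) \<in> borel_measurable lebesgue" for n
        proof -
          have "q n \<in> borel_measurable borel"
            by (intro borel_measurable_continuous_onI C1c_continuous[OF q])
          then have "q n \<in> borel_measurable lebesgue" by (simp add: measurable_completion)
          then show ?thesis
            using borel_measurable_integrable[OF h]
            by (intro borel_measurable_times borel_measurable_const)
        qed
        show "(\<lambda>t. indicator {a<..<b} t * h t) \<in> borel_measurable lebesgue"
          using h by (intro borel_measurable_times borel_measurable_indicator borel_measurable_integrable) auto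
        show "AE t in lebesgue. (\<lambda>n. h t * (real n * q n t)) \<longlonglongrightarrow> indicator {a<..<b} t * h t"
        proof (rule AE_I2)
          fix t
          show "(\<lambda>n. h t * (real n * q n t)) \<longlonglongrightarrow> indicator {a<..<b} t * h t"
          proof (cases "t \<in> {x<..<y}")
            case True
            then have "(\<lambda>n. h t * (real n * q n t)) \<longlonglongrightarrow> h t * 1"
              unfolding q_def by (intro tendsto_mult tendsto_const tendsto_bump_quotient) (simp add: bump_pos_iff)
            then show ?thesis using True by (simp add: x_def y_def indicator_def)
          next
            case False
            then have "indicator {a<..<b} t * h t = 0" by (auto simp: x_def y_def h_def indicator_def)
            moreover have "h t * (real n * q n t) = 0" for n using False by (simp add: q_def bump_eq_0)
            ultimately show ?thesis by (simp only: tendsto_const)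
          qed
        qed
        show "AE t in lebesgue. norm (h t * (real n * q n t)) \<le> \<bar>h t\<bar>" for n
        proof (rule AE_I2)
          fix t
          have p: "real n * bump x y t \<ge> 0" using bump_nonneg by simp
          then have "\<bar>real n * q n t\<bar> \<le> 1" by (simp add: q_def divide_le_eq)
          then show "norm (h t * (real n * q n t)) \<le> \<bar>h t\<bar>"
            using mult_left_mono[of "\<bar>real n * q n t\<bar>" 1 "\<bar>h t\<bar>"] by (simp add: abs_mult)
        qed
        show "integrable lebesgue (\<lambda>t. \<bar>h t\<bar>)" using h by simp
      qed
      then show ?thesis by (simp add: zero LIMSEQ_const_iff)
    qed
    from AE_zero_if_integral_intervals_zero[OF h this] show ?thesis
      by eventually_elim (auto simp: h_def)
  qed
  \<comment> \<open>Countably many subintervals exhaust (0, \<open>L\<close>); the shift by one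
    avoids division by zero.\<close>
  have "AE t in lebesgue. \<forall>n. t \<in> {L / (real n + 1)<..<L - L / (real n + 1)} \<longrightarrow> f t = 0"
    unfolding AE_all_countable using L by (intro allI key) (auto simp: add_pos_nonneg)
  then have "AE t in lebesgue. t \<in> {0<..<L} \<longrightarrow> f t = 0"
  proof eventually_elim
    case (elim t)
    show ?case
    proof
      assume t: "t \<in> {0<..<L}"
      have "filterlim (\<lambda>n. real n + 1) at_top sequentially"
        by (rule filterlim_at_top_mono[OF filterlim_real_sequentially]) auto
      then have "(\<lambda>n. L / (real n + 1)) \<longlonglongrightarrow> 0"
        by (intro real_tendsto_divide_at_top[OF tendsto_const])
      then have "\<forall>\<^sub>F n in sequentially. L / (real n + 1) < min t (L - t)"
        by (rule order_tendstoD) (use t in auto)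
      then obtain n where "L / (real n + 1) < min t (L - t)"
        by (meson eventually_happens sequentially_bot)
      then show "f t = 0" using elim[rule_format, of n] by auto
    qed
  qed
  then show ?thesis by (simp add: AE_restrict_space_iff)
qed

section \<open>The du Bois-Reymond lemma\<close>

lemma integrable_leb_mult_continuous:
  assumes "integrable (leb L) w" "continuous_on {0..L} (\<xi> :: real \<Rightarrow> real)"
  shows "integrable (leb L) (\<lambda>t. w t * \<xi> t)"
proof -
  have "bounded (\<xi> ` {0<..<L})"
    by (rule bounded_subset[OF compact_imp_bounded[OF compact_continuous_image[OF assms(2)]]]) auto
  moreover have "continuous_on {0<..<L} \<xi>" using assms(2) by (rule continuous_on_subset) auto
  ultimately have "(\<lambda>t. \<xi> t * w t) absolutely_integrable_on {0<..<L}"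
    using assms(1)
    by (intro absolutely_integrable_bounded_measurable_product_real
        continuous_imp_measurable_on_sets_lebesgue) (auto simp: integrable_lebesgue_on_iff)
  then show ?thesis by (simp add: integrable_lebesgue_on_iff mult.commute)
qed

text \<open>The primitive starting at 0 vanishes to the left of the support of \<eta>. To the right
  it is constant, and the zero mean makes that constant zero, so the primitive has compact support
  as well.\<close>

lemma C1c_primitive:
  assumes cont: "continuous_on UNIV \<eta>" and xy: "0 < x" "x \<le> y" "y < L"
    and supp: "\<And>t. t \<notin> {x..y} \<Longrightarrow> \<eta> t = 0" and mean: "integral {0..L} \<eta> = 0"
  obtains \<psi> where "\<psi> \<in> C1c L" "deriv \<psi> = \<eta>"
proof -
  define \<psi> where "\<psi> t = integral {0..t} \<eta>" for t
  have i: "\<eta> integrable_on {a..b}" for a b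
    using cont continuous_on_subset by (blast intro: integrable_continuous_real)
  have right: "integral {0..t} \<eta> = integral {0..y} \<eta>" if "y \<le> t" for t
  proof -
    have "integral {y..t} \<eta> = integral {y..t} (\<lambda>_. 0)"
      \<comment> \<open>At the endpoint \<open>y\<close> itself \<eta> is not known to vanish, hence
        the exceptional point.\<close>
      by (rule integral_spike[where S="{y}"]) (use supp in auto)
    then show ?thesis
      using Henstock_Kurzweil_Integration.integral_combine[OF _ that i, of 0] xy by simp
  qed
  have zero: "\<psi> t = 0" if "t \<notin> {x..y}" for t
  proof (cases "t < x")
    case True
    have "integral {0..t} \<eta> = integral {0..t} (\<lambda>_. 0)"
      by (rule Henstock_Kurzweil_Integration.integral_cong) (use supp True in auto)
    then show ?thesis by (simp add: \<psi>_def)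
  next
    case False
    then show ?thesis using that right[of t] right[of L] xy mean by (simp add: \<psi>_def)
  qed
  have "(\<psi> has_real_derivative \<eta> t) (at t)" for t
  proof (cases "t \<in> {x..y}")
    case True
    have "(\<psi> has_real_derivative \<eta> t) (at t within {0..L})"
      unfolding \<psi>_def using True xy
      by (intro integral_has_real_derivative continuous_on_subset[OF cont]) auto
    moreover have "at t within {0..L} = at t" using True xy by (intro at_within_interior) auto
    ultimately show ?thesis by simp
  next
    case False
    have "((\<lambda>_. 0) has_real_derivative \<eta> t) (at t)" using supp[OF False] by simp
    then show ?thesis
      by (rule has_field_derivative_transform_within_open[where S="- {x..y}"])
        (use False zero in auto)
  qed
  from C1cI[OF this cont zero xy(1,3)] show ?thesis using that by blast
qed

text \<open>Subtracting a multiple of one fixed bump \<open>b\<close> gives any test function zero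
  mean and thus makes it the derivative of a test function. Hence \<open>w\<close> minus its
  \<open>b\<close>-weighted mean annihilates all test functions.\<close>

lemma du_Bois_Reymond:
  assumes L: "L > 0" and w: "integrable (leb L) w"
    and z: "\<And>\<psi>. \<psi> \<in> C1c L \<Longrightarrow> (LINT x|leb L. w x * deriv \<psi> x) = 0"
  obtains c where "AE x in leb L. w x = c"
proof -
  define b where "b = bump (L/4) (L/2)"
  \<comment> \<open>The quotient with k = 0 is the bump itself.\<close>
  have b: "b \<in> C1c L" using bump_quotient_in_C1c[of "L/4" "L/2" L 0] L by (simp add: b_def)
  define I where "I = integral {0..L} b"
  have "integral {0..L} b \<noteq> 0"
  proof
    assume "integral {0..L} b = 0"
    then have "(b has_integral 0) (cbox 0 L)"
      using integrable_continuous_real[OF C1c_continuous[OF b]] by (metis box_real(2) has_integral_integrable_integral)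
    \<comment> \<open>A continuous nonnegative function with zero integral vanishes everywhere, in
      particular at the midpoint of (\<open>L/4\<close>, \<open>L/2\<close>), where \<open>b\<close>
      is positive.\<close>
    then have "b (3*L/8) = 0"
      by (rule has_integral_0_cbox_imp_0[OF C1c_continuous[OF b], rotated])
        (use L bump_nonneg in \<open>auto simp: b_def box_real\<close>)
    moreover have "b (3*L/8) > 0" using L by (simp add: b_def bump_pos_iff)
    ultimately show False by simp
  qed
  then have I: "I \<noteq> 0" by (simp add: I_def)
  define c where "c = (LINT x|leb L. w x * b x) / I"
  have mi: "integrable (leb L) (\<lambda>t. w t * \<xi> t)" if "\<xi> \<in> C1c L" for \<xi>
    by (rule integrable_leb_mult_continuous[OF w C1c_continuous[OF that]])
  have "AE x in leb L. w x - c = 0"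
  proof (rule fundamental_lemma_variations[OF L])
    show "(\<lambda>x. w x - c) \<in> L1_loc L"
      unfolding L1_loc_def
    proof clarify
      fix K :: "real set" assume K: "compact K" "K \<subseteq> {0<..<L}"
      have "(\<lambda>x. w x - c) absolutely_integrable_on {0<..<L}"
        using w by (intro set_integral_diff) (auto simp: integrable_lebesgue_on_iff)
      then show "integrable (lebesgue_on K) (\<lambda>x. w x - c)"
        using K by (simp add: integrable_lebesgue_on_iff lmeasurable_compact fmeasurableD set_integrable_subset)
    qed
    fix \<xi> assume \<xi>: "\<xi> \<in> C1c L"
    define J where "J = integral {0..L} \<xi>"
    \<comment> \<open>The coefficient is chosen so that \<eta> has integral
      \<open>J - J / I * I = 0\<close>.\<close>
    define \<eta> where "\<eta> t = \<xi> t - J / I * b t" for t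
    obtain x1 y1 where xy1: "0 < x1" "x1 \<le> y1" "y1 < L" "\<And>t. t \<notin> {x1..y1} \<Longrightarrow> \<xi> t = 0 \<and> deriv \<xi> t = 0"
      using C1c_supportE[OF \<xi> L] by metis
    obtain x2 y2 where xy2: "0 < x2" "x2 \<le> y2" "y2 < L" "\<And>t. t \<notin> {x2..y2} \<Longrightarrow> b t = 0 \<and> deriv b t = 0"
      using C1c_supportE[OF b L] by metis
    obtain \<psi> where \<psi>: "\<psi> \<in> C1c L" "deriv \<psi> = \<eta>"
    proof (rule C1c_primitive)
      show "continuous_on UNIV \<eta>" unfolding \<eta>_def by (intro continuous_intros C1c_continuous[OF \<xi>] C1c_continuous[OF b])
      show "0 < min x1 x2" "min x1 x2 \<le> max y1 y2" "max y1 y2 < L" using xy1 xy2 by auto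
      show "\<eta> t = 0" if "t \<notin> {min x1 x2..max y1 y2}" for t
      proof -
        have "t \<notin> {x1..y1}" "t \<notin> {x2..y2}" using that by auto
        then show ?thesis using xy1(4)[of t] xy2(4)[of t] by (simp add: \<eta>_def)
      qed
      have "integral {0..L} \<eta> = integral {0..L} \<xi> - integral {0..L} (\<lambda>t. J / I * b t)" unfolding \<eta>_def
        by (intro Henstock_Kurzweil_Integration.integral_diff integrable_continuous_real
            continuous_on_mult continuous_on_const C1c_continuous[OF \<xi>] C1c_continuous[OF b])
      also have "\<dots> = J - J / I * I" by (simp only: J_def I_def integral_mult_right)
      finally show "integral {0..L} \<eta> = 0" using I by simp
    qed
    have "0 = (LINT x|leb L. w x * \<xi> x - J / I * (w x * b x))"
      using z[OF \<psi>(1)] unfolding \<psi>(2) by (simp add: \<eta>_def algebra_simps)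
    also have "\<dots> = (LINT x|leb L. w x * \<xi> x) - J * c"
      using mi \<xi> b by (subst Bochner_Integration.integral_diff) (auto simp: c_def)
    finally have "(LINT x|leb L. w x * \<xi> x) = c * J" by (simp add: mult.commute)
    moreover have "(LINT x|leb L. c * \<xi> x) = c * J" "integrable (leb L) (\<lambda>x. c * \<xi> x)"
      using continuous_integrable_leb[OF C1c_continuous[OF \<xi>]] by (auto simp: J_def)
    ultimately show "(LINT x|leb L. (w x - c) * \<xi> x) = 0"
      using mi[OF \<xi>] by (auto simp: left_diff_distrib Bochner_Integration.integral_diff)
  qed
  then show ?thesis by (intro that[of c]) auto
qed

subsection \<open>Sobolev functions on the interval\<close>

lemma continuous_L1_loc:
  assumes "continuous_on UNIV f"
  shows "f \<in> L1_loc L"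
  unfolding L1_loc_def
proof clarify
  fix K :: "real set" assume K: "compact K" "K \<subseteq> {0<..<L}"
  have "f absolutely_integrable_on {0..L}"
    using assms continuous_on_subset absolutely_integrable_continuous_real by blast
  moreover have "K \<in> sets lebesgue" using K(1) by (simp add: lmeasurable_compact fmeasurableD)
  moreover have "K \<subseteq> {0..L}" using K(2) by auto
  ultimately show "integrable (lebesgue_on K) f"
    by (simp add: integrable_lebesgue_on_iff set_integrable_subset)
qed

text \<open>Integration by parts; the boundary terms vanish because test functions are zero at 0 and
  \<open>L\<close>.\<close>

lemma C1c_weak_derivative:
  assumes L: "L > 0" and \<psi>: "\<psi> \<in> C1c L"
  shows "has_weak_derivative L \<psi> (deriv \<psi>)"
  unfolding has_weak_derivative_def
proof (intro conjI ballI)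
  show "\<psi> \<in> L1_loc L" "deriv \<psi> \<in> L1_loc L"
    by (intro continuous_L1_loc C1c_continuous[OF \<psi>] C1c_continuous_deriv[OF \<psi>])+
  fix \<xi> assume \<xi>: "\<xi> \<in> C1c L"
  note cs = C1c_continuous[OF \<psi>] C1c_continuous_deriv[OF \<psi>] C1c_continuous[OF \<xi>] C1c_continuous_deriv[OF \<xi>]
  have c: "continuous_on {0..L} (\<lambda>x. \<psi> x * deriv \<xi> x)" "continuous_on {0..L} (\<lambda>x. deriv \<psi> x * \<xi> x)"
    by (intro continuous_intros cs)+
  have "((\<lambda>x. \<psi> x * \<xi> x) has_real_derivative \<psi> x * deriv \<xi> x + deriv \<psi> x * \<xi> x) (at x within {0..L})" for x
    using DERIV_mult[OF C1c_has_derivative[OF \<psi>] C1c_has_derivative[OF \<xi>], of x]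
    by (auto simp: mult.commute add.commute intro: has_field_derivative_at_within)
  then have "((\<lambda>x. \<psi> x * deriv \<xi> x + deriv \<psi> x * \<xi> x) has_integral \<psi> L * \<xi> L - \<psi> 0 * \<xi> 0) {0..L}"
    using L by (intro fundamental_theorem_of_calculus)
      (auto simp: has_real_derivative_iff_has_vector_derivative)
  then have "integral {0..L} (\<lambda>x. \<psi> x * deriv \<xi> x + deriv \<psi> x * \<xi> x) = 0"
    using C1c_outside[OF \<psi>] by (simp add: integral_unique)
  then have "integral {0..L} (\<lambda>x. \<psi> x * deriv \<xi> x) + integral {0..L} (\<lambda>x. deriv \<psi> x * \<xi> x) = 0"
    by (subst (asm) Henstock_Kurzweil_Integration.integral_add) (auto intro: integrable_continuous_real c)
  then show "(LINT x|leb L. \<psi> x * deriv \<xi> x) = - (LINT x|leb L. deriv \<psi> x * \<xi> x)"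
    using c by (simp add: continuous_integrable_leb)
qed

lemma continuous_in_Lp:
  assumes "continuous_on {0..L} f" "p > 0"
  shows "f \<in> Lp L p"
  unfolding Lp_def
proof (intro CollectI conjI)
  show "f \<in> borel_measurable (leb L)"
    using continuous_integrable_leb(1)[OF assms(1)] by (rule borel_measurable_integrable)
  show "integrable (leb L) (\<lambda>x. \<bar>f x\<bar> powr p)"
    using assms by (intro continuous_integrable_leb continuous_on_powr' continuous_intros) auto
qed

lemma C1c_in_W1p0:
  assumes "L > 0" "p > 0" "\<psi> \<in> C1c L"
  shows "\<psi> \<in> W1p0 L p"
proof -
  have "\<exists>\<xi>\<in>C1c L. Lp_norm L p (\<lambda>x. \<psi> x - \<xi> x) + Lp_norm L p (\<lambda>x. deriv \<psi> x - deriv \<xi> x) < \<epsilon>"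
    if "0 < \<epsilon>" for \<epsilon>
    \<comment> \<open>A test function approximates itself with error zero.\<close>
    using assms(3) that by (intro bexI[of _ \<psi>]) (auto simp: Lp_norm_def)
  moreover have "\<psi> \<in> Lp L p" "deriv \<psi> \<in> Lp L p"
    using assms by (auto intro!: continuous_in_Lp C1c_continuous C1c_continuous_deriv)
  ultimately show ?thesis
    using C1c_weak_derivative[OF assms(1,3)] C1c_continuous[OF assms(3)] unfolding W1p0_def by blast
qed

lemma C1c_lipschitz:
  assumes "\<psi> \<in> C1c L"
  shows "\<exists>C. C-lipschitz_on {0..L} \<psi>"
proof -
  have "bounded (deriv \<psi> ` {0..L})"
    by (intro compact_imp_bounded compact_continuous_image C1c_continuous_deriv[OF assms]) auto
  then obtain C where C: "C > 0" "\<And>x. x \<in> {0..L} \<Longrightarrow> \<bar>deriv \<psi> x\<bar> \<le> C"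
    unfolding bounded_pos by auto
  have "C-lipschitz_on {0..L} \<psi>"
  proof (rule bounded_derivative_imp_lipschitz[where f'="\<lambda>x. (*) (deriv \<psi> x)"])
    show "(\<psi> has_derivative (*) (deriv \<psi> x)) (at x within {0..L})" for x
      using C1c_has_derivative[OF assms, of x]
      by (simp add: has_field_derivative_def has_derivative_at_withinI)
    show "onorm ((*) (deriv \<psi> x)) \<le> C" if "x \<in> {0..L}" for x
      using C(2)[OF that] C(1) by (intro onorm_bound) (auto simp: abs_mult mult_right_mono)
  qed (use C(1) in auto)
  then show ?thesis ..
qed

section \<open>Null sets and uniqueness of weak derivatives\<close>

lemma AE_leb_negligible:
  assumes "AE x in leb L. P x"
  obtains N where "negligible N" "\<And>x. x \<in> {0<..<L} - N \<Longrightarrow> P x"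
proof -
  have "AE x in lebesgue. x \<in> {0<..<L} \<longrightarrow> P x"
    using assms by (simp add: AE_restrict_space_iff)
  then obtain N where "{x \<in> space lebesgue. \<not> (x \<in> {0<..<L} \<longrightarrow> P x)} \<subseteq> N" "N \<in> null_sets lebesgue"
    unfolding eventually_ae_filter by blast
  then show ?thesis by (intro that[of N]) (auto simp: negligible_iff_null_sets)
qed

text \<open>Completeness of Lebesgue measure lets measurability pass from \<open>f\<close> to
  \<open>h\<close>.\<close>

lemma integrable_leb_AE_cong:
  fixes f :: "real \<Rightarrow> real"
  assumes "integrable (leb L) f" "AE x in leb L. h x = f x"
  shows "integrable (leb L) h"
proof -
  obtain N where N: "negligible N" "\<And>x. x \<in> {0<..<L} - N \<Longrightarrow> h x = f x"
    using AE_leb_negligible[OF assms(2)] by metis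
  have "f absolutely_integrable_on {0<..<L}"
    using assms(1) by (simp add: integrable_lebesgue_on_iff)
  from absolutely_integrable_spike[OF this N] show ?thesis
    by (simp add: integrable_lebesgue_on_iff)
qed

text \<open>The difference of two weak derivatives pairs to zero with every test function, so the
  fundamental lemma applies.\<close>

lemma weak_derivative_unique:
  assumes L: "L > 0" and 1: "has_weak_derivative L u f" and 2: "has_weak_derivative L u h"
  shows "AE x in leb L. f x = h x"
proof -
  have f: "f \<in> L1_loc L" and h: "h \<in> L1_loc L" using 1 2 by (auto simp: has_weak_derivative_def)
  have "AE x in leb L. f x - h x = 0"
  proof (rule fundamental_lemma_variations[OF L])
    show "(\<lambda>x. f x - h x) \<in> L1_loc L" using f h by (simp add: L1_loc_def)
    fix \<psi> assume \<psi>: "\<psi> \<in> C1c L"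
    obtain x y where xy: "0 < x" "y < L" "\<And>t. t \<notin> {x..y} \<Longrightarrow> \<psi> t = 0"
      using C1c_supportE[OF \<psi> L] by metis
    note L1_loc_mult_integrable[OF f C1c_continuous[OF \<psi>] xy]
      L1_loc_mult_integrable[OF h C1c_continuous[OF \<psi>] xy]
    moreover have "(LINT x|leb L. f x * \<psi> x) = (LINT x|leb L. h x * \<psi> x)"
    proof -
      have "(LINT x|leb L. u x * deriv \<psi> x) = - (LINT x|leb L. f x * \<psi> x)"
        "(LINT x|leb L. u x * deriv \<psi> x) = - (LINT x|leb L. h x * \<psi> x)"
        using 1 2 \<psi> unfolding has_weak_derivative_def by blast+
      then show ?thesis by simp
    qed
    ultimately show "(LINT x|leb L. (f x - h x) * \<psi> x) = 0"
      by (simp add: left_diff_distrib Bochner_Integration.integral_diff)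
  qed
  then show ?thesis by simp
qed

section \<open>Comparison of \<open>Lp\<close> with integrable functions on a bounded
  interval\<close>

lemma const_integrable_leb: "integrable (leb L) (\<lambda>x. c :: real)"
  by (rule continuous_integrable_leb) simp

lemma Lp_integrable:
  assumes "f \<in> Lp L p" "p \<ge> 1"
  shows "integrable (leb L) f"
proof (rule Bochner_Integration.integrable_bound)
  show "integrable (leb L) (\<lambda>x. 1 + \<bar>f x\<bar> powr p)" "f \<in> borel_measurable (leb L)"
    using assms by (auto simp: Lp_def const_integrable_leb)
  \<comment> \<open>The constant 1 covers small values and is integrable since the interval is
    bounded.\<close>
  have "\<bar>t\<bar> \<le> 1 + \<bar>t\<bar> powr p" for t :: real
  proof (cases "\<bar>t\<bar> \<le> 1")
    case False
    then have "\<bar>t\<bar> powr 1 \<le> \<bar>t\<bar> powr p" using assms(2) by (intro powr_mono) auto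
    then show ?thesis by simp
  qed (simp add: add_increasing2)
  then show "AE x in leb L. norm (f x) \<le> norm (1 + \<bar>f x\<bar> powr p)"
    by (intro AE_I2) (simp add: abs_of_nonneg add_nonneg_nonneg)
qed

lemma Lp_diff:
  assumes "f \<in> Lp L p" "h \<in> Lp L p" "p \<ge> 1"
  shows "(\<lambda>x. f x - h x) \<in> Lp L p"
proof -
  have m: "f \<in> borel_measurable (leb L)" "h \<in> borel_measurable (leb L)" using assms by (auto simp: Lp_def)
  have "\<bar>s - t\<bar> powr p \<le> 2 powr p * (\<bar>s\<bar> powr p + \<bar>t\<bar> powr p)" for s t :: real
  proof -
    have "\<bar>s - t\<bar> powr p \<le> (2 * max \<bar>s\<bar> \<bar>t\<bar>) powr p" using assms(3) by (intro powr_mono2) auto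
    also have "\<dots> = 2 powr p * max \<bar>s\<bar> \<bar>t\<bar> powr p" by (simp add: powr_mult)
    also have "\<dots> \<le> 2 powr p * (\<bar>s\<bar> powr p + \<bar>t\<bar> powr p)" by (intro mult_left_mono) (auto simp: max_def)
    finally show ?thesis .
  qed
  then have bd: "AE x in leb L. norm (\<bar>f x - h x\<bar> powr p) \<le> norm (2 powr p * (\<bar>f x\<bar> powr p + \<bar>h x\<bar> powr p))"
    by (intro AE_I2) simp
  have "integrable (leb L) (\<lambda>x. 2 powr p * (\<bar>f x\<bar> powr p + \<bar>h x\<bar> powr p))"
    using assms by (simp add: Lp_def)
  moreover have "(\<lambda>x. \<bar>f x - h x\<bar> powr p) \<in> borel_measurable (leb L)"
    using m by measurable
  ultimately have "integrable (leb L) (\<lambda>x. \<bar>f x - h x\<bar> powr p)"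
    using bd by (rule Bochner_Integration.integrable_bound)
  then show ?thesis using m by (simp add: Lp_def)
qed

text \<open>In place of Hoelder's inequality, the pointwise bound \<open>\<bar>t\<bar> \<le> e + e
  powr (1 - p) * \<bar>t\<bar> powr p\<close> is integrated: small values are absorbed by
  \<open>e\<close>, large ones by the power.\<close>

lemma Lp_norm_small_imp_L1_small:
  assumes L: "L > 0" and p: "p \<ge> 1" and "\<epsilon> > 0"
  obtains \<delta> where "\<delta> > 0"
    "\<And>f. f \<in> Lp L p \<Longrightarrow> Lp_norm L p f < \<delta> \<Longrightarrow> (LINT x|leb L. \<bar>f x\<bar>) < \<epsilon>"
proof -
  \<comment> \<open>\<open>e\<close> integrates to \<epsilon>/2 over (0, \<open>L\<close>), and
    \<delta> is chosen so that the power term contributes less than \<epsilon>/2.\<close>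
  define e where "e = \<epsilon> / (2 * L)"
  define \<delta> where "\<delta> = (e powr (p - 1) * (\<epsilon> / 2)) powr (1 / p)"
  have e: "e > 0" using assms by (simp add: e_def)
  have \<delta>: "\<delta> > 0" using e assms by (simp add: \<delta>_def)
  show ?thesis
  proof (rule that[OF \<delta>])
    fix f assume f: "f \<in> Lp L p" and small: "Lp_norm L p f < \<delta>"
    define A where "A = (LINT x|leb L. \<bar>f x\<bar> powr p)"
    have A: "A \<ge> 0" unfolding A_def by (rule Bochner_Integration.integral_nonneg) simp
    have "A = Lp_norm L p f powr p" using A p by (simp add: Lp_norm_def A_def[symmetric] powr_powr)
    also have "\<dots> < \<delta> powr p" using small p by (intro powr_less_mono2) (auto simp: Lp_norm_def)
    also have "\<dots> = e powr (p - 1) * (\<epsilon> / 2)" using p e assms by (simp add: \<delta>_def powr_powr)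
    finally have "e powr (1 - p) * A < e powr (1 - p) * (e powr (p - 1) * (\<epsilon> / 2))"
      using e by simp
    also have "\<dots> = \<epsilon> / 2" using e by (simp add: mult.assoc[symmetric] powr_add[symmetric])
    finally have *: "e powr (1 - p) * A < \<epsilon> / 2" .
    have pt: "\<bar>t\<bar> \<le> e + e powr (1 - p) * \<bar>t\<bar> powr p" for t
    proof (cases "\<bar>t\<bar> \<le> e")
      case False
      have "\<bar>t\<bar> = \<bar>t\<bar> powr (1 - p) * \<bar>t\<bar> powr p" using False e by (simp add: powr_add[symmetric])
      also have "\<dots> \<le> e powr (1 - p) * \<bar>t\<bar> powr p"
        using False e p by (intro mult_right_mono powr_mono2') auto
      finally show ?thesis using e by simp
    qed (simp add: add_increasing2)
    have ip: "integrable (leb L) (\<lambda>x. \<bar>f x\<bar> powr p)" using f by (simp add: Lp_def)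
    have "(LINT x|leb L. \<bar>f x\<bar>) \<le> (LINT x|leb L. e + e powr (1 - p) * \<bar>f x\<bar> powr p)"
      using Lp_integrable[OF f p] ip pt
      by (intro integral_mono Bochner_Integration.integrable_add const_integrable_leb
          integrable_mult_right integrable_abs) auto
    also have "\<dots> = (LINT x|leb L. e) + e powr (1 - p) * A"
      using ip by (subst Bochner_Integration.integral_add) (auto simp: const_integrable_leb A_def)
    also have "(LINT x|leb L. e) = \<epsilon> / 2" using L continuous_integrable_leb(2)[of L "\<lambda>_. e"]
      by (simp add: e_def)
    finally show "(LINT x|leb L. \<bar>f x\<bar>) < \<epsilon>" using * by simp
  qed
qed

text \<open>Test functions approximating \<open>u\<close> in the Sobolev norm converge to
  \<open>u\<close> in the mean and, being integrals of their derivatives, uniformly to the primitive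
  \<open>U\<close> of \<open>du\<close>. Continuity turns equality in the mean into equality at
  every point, and the boundary value at \<open>L\<close> survives the uniform limit.\<close>

lemma W1p0_eq_integral:
  assumes L: "L > 0" and p: "p \<ge> 1" and u: "u \<in> W1p0 L p" and du: "has_weak_derivative L u du"
  shows "integrable (leb L) du" "\<And>x. x \<in> {0..L} \<Longrightarrow> u x = integral {0..x} du" "u L = 0"
proof -
  obtain v where uc: "continuous_on {0..L} u" and uL: "u \<in> Lp L p" and v: "v \<in> Lp L p"
    "has_weak_derivative L u v"
    and ap: "\<And>\<epsilon>. \<epsilon> > 0 \<Longrightarrow> \<exists>\<psi> \<in> C1c L. Lp_norm L p (\<lambda>x. u x - \<psi> x) + Lp_norm L p (\<lambda>x. v x - deriv \<psi> x) < \<epsilon>"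
    using u unfolding W1p0_def by blast
  \<comment> \<open>The approximation is known only for the derivative \<open>v\<close> supplied by
    the definition of \<open>W1p0\<close>; uniqueness transfers it to \<open>du\<close>.\<close>
  have ae: "AE x in leb L. du x = v x" by (rule weak_derivative_unique[OF L du v(2)])
  show i: "integrable (leb L) du"
    by (rule integrable_leb_AE_cong[OF Lp_integrable[OF v(1) p] ae])
  then have ai: "du absolutely_integrable_on {0..L}" by (simp add: integrable_leb_iff_closed)
  define U where "U x = integral {0..x} du" for x
  have Uc: "continuous_on {0..L} U"
    unfolding U_def using ai set_lebesgue_integral_eq_integral(1) by (intro indefinite_integral_continuous_1) auto
  have close: "\<exists>\<psi>\<in>C1c L. (LINT x|leb L. \<bar>u x - \<psi> x\<bar>) < \<epsilon> \<and> (\<forall>x\<in>{0..L}. \<bar>\<psi> x - U x\<bar> < \<epsilon>)"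
    if \<epsilon>: "\<epsilon> > 0" for \<epsilon>
  proof -
    obtain \<delta> where \<delta>: "\<delta> > 0" "\<And>f. f \<in> Lp L p \<Longrightarrow> Lp_norm L p f < \<delta> \<Longrightarrow> (LINT x|leb L. \<bar>f x\<bar>) < \<epsilon>"
      using Lp_norm_small_imp_L1_small[OF L p \<epsilon>] by blast
    obtain \<psi> where \<psi>: "\<psi> \<in> C1c L"
      and sm: "Lp_norm L p (\<lambda>x. u x - \<psi> x) + Lp_norm L p (\<lambda>x. v x - deriv \<psi> x) < \<delta>"
      using ap[OF \<delta>(1)] by blast
    have "Lp_norm L p (\<lambda>x. u x - \<psi> x) \<ge> 0" "Lp_norm L p (\<lambda>x. v x - deriv \<psi> x) \<ge> 0"
      by (simp_all add: Lp_norm_def)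
    with sm have "Lp_norm L p (\<lambda>x. u x - \<psi> x) < \<delta>" "Lp_norm L p (\<lambda>x. v x - deriv \<psi> x) < \<delta>" by linarith+
    moreover have "\<psi> \<in> Lp L p" "deriv \<psi> \<in> Lp L p"
      using p by (auto intro!: continuous_in_Lp C1c_continuous[OF \<psi>] C1c_continuous_deriv[OF \<psi>])
    ultimately have 1: "(LINT x|leb L. \<bar>u x - \<psi> x\<bar>) < \<epsilon>" and "(LINT x|leb L. \<bar>v x - deriv \<psi> x\<bar>) < \<epsilon>"
      using \<delta>(2) Lp_diff uL v(1) p by blast+
    moreover have di: "integrable (leb L) (deriv \<psi>)"
      by (rule continuous_integrable_leb[OF C1c_continuous_deriv[OF \<psi>]])
    moreover have "(LINT x|leb L. \<bar>v x - deriv \<psi> x\<bar>) = (LINT x|leb L. \<bar>du x - deriv \<psi> x\<bar>)"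
      using ae i Lp_integrable[OF v(1) p] di
      by (intro integral_cong_AE) (auto intro: borel_measurable_integrable)
    ultimately have 2: "(LINT x|leb L. \<bar>du x - deriv \<psi> x\<bar>) < \<epsilon>" by simp
    have dai: "(\<lambda>x. du x - deriv \<psi> x) absolutely_integrable_on {0..L}"
      by (rule set_integral_diff(1)[OF ai absolutely_integrable_continuous_real[OF C1c_continuous_deriv[OF \<psi>]]])
    have "integrable (leb L) (\<lambda>x. \<bar>du x - deriv \<psi> x\<bar>)" using i di by simp
    from lebesgue_integral_eq_integral[OF this] 2
    have 3: "integral {0..L} (\<lambda>x. \<bar>du x - deriv \<psi> x\<bar>) < \<epsilon>"
      by (simp add: integral_open_interval_real)
    \<comment> \<open>Since \<psi> vanishes at 0, the difference is the integral of
      \<open>du - deriv \<psi>\<close> from 0 to \<open>x\<close>.\<close>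
    have "\<bar>\<psi> x - U x\<bar> < \<epsilon>" if x: "x \<in> {0..L}" for x
    proof -
      have sub: "f absolutely_integrable_on {0..x}" if "f absolutely_integrable_on {0..L}" for f :: "real \<Rightarrow> real"
        using absolutely_integrable_on_subinterval[OF that] x by simp
      have "(deriv \<psi> has_integral \<psi> x - \<psi> 0) {0..x}"
        using x C1c_has_derivative[OF \<psi>] by (intro fundamental_theorem_of_calculus)
          (auto simp: has_real_derivative_iff_has_vector_derivative[symmetric] intro: has_field_derivative_at_within)
      then have "((\<lambda>t. du t - deriv \<psi> t) has_integral U x - \<psi> x) {0..x}"
        using C1c_outside[OF \<psi>, of 0] set_lebesgue_integral_eq_integral(1)[OF sub[OF ai]] unfolding U_def
        by (intro has_integral_diff integrable_integral) auto
      then have "\<bar>\<psi> x - U x\<bar> = norm (integral {0..x} (\<lambda>t. du t - deriv \<psi> t))"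
        by (simp add: integral_unique abs_minus_commute)
      also have "\<dots> \<le> integral {0..x} (\<lambda>t. norm (du t - deriv \<psi> t))"
        using sub[OF dai] unfolding absolutely_integrable_on_def
        by (intro Henstock_Kurzweil_Integration.integral_norm_bound_integral) auto
      also have "\<dots> \<le> integral {0..L} (\<lambda>t. norm (du t - deriv \<psi> t))"
        using x dai sub[OF dai] unfolding absolutely_integrable_on_def by (intro integral_subset_le) auto
      finally show ?thesis using 3 by simp
    qed
    then show ?thesis using 1 \<psi> by blast
  qed
  have UL: "U L = 0"
  proof (rule ccontr)
    assume "U L \<noteq> 0"
    \<comment> \<open>With \<psi> zero at \<open>L\<close>, an error below the absolute value of
      \<open>U L\<close> is impossible.\<close>
    then obtain \<psi> where "\<psi> \<in> C1c L" "\<bar>\<psi> L - U L\<bar> < \<bar>U L\<bar>"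
      using close[of "\<bar>U L\<bar>"] L by auto
    then show False using C1c_outside[of \<psi> L L] by simp
  qed
  define I where "I = integral {0..L} (\<lambda>x. \<bar>u x - U x\<bar>)"
  have I0: "I \<ge> 0" unfolding I_def by (rule Henstock_Kurzweil_Integration.integral_nonneg)
      (auto intro!: integrable_continuous_real continuous_intros uc Uc)
  have "I \<le> \<epsilon> + \<epsilon> * L" if \<epsilon>: "\<epsilon> > 0" for \<epsilon>
  proof -
    obtain \<psi> where \<psi>: "\<psi> \<in> C1c L" "(LINT x|leb L. \<bar>u x - \<psi> x\<bar>) < \<epsilon>" "\<And>x. x\<in>{0..L} \<Longrightarrow> \<bar>\<psi> x - U x\<bar> < \<epsilon>"
      using close[OF \<epsilon>] by blast
    have c: "continuous_on {0..L} (\<lambda>x. \<bar>u x - \<psi> x\<bar>)"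
      by (intro continuous_intros uc C1c_continuous[OF \<psi>(1)])
    have "I \<le> integral {0..L} (\<lambda>x. \<bar>u x - \<psi> x\<bar> + \<epsilon>)"
      unfolding I_def
    proof (rule integral_le)
      show "\<bar>u x - U x\<bar> \<le> \<bar>u x - \<psi> x\<bar> + \<epsilon>" if "x \<in> {0..L}" for x
        using \<psi>(3)[OF that] by linarith
    qed (auto intro!: integrable_continuous_real continuous_intros uc Uc c)
    also have "\<dots> = integral {0..L} (\<lambda>x. \<bar>u x - \<psi> x\<bar>) + \<epsilon> * L"
      using L by (subst Henstock_Kurzweil_Integration.integral_add)
        (auto intro!: integrable_continuous_real c)
    also have "integral {0..L} (\<lambda>x. \<bar>u x - \<psi> x\<bar>) < \<epsilon>"
      using \<psi>(2) continuous_integrable_leb(2)[OF c] by simp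
    finally show ?thesis by simp
  qed
  \<comment> \<open>If \<open>I\<close> were positive, this choice of \<epsilon> would give
    \<open>I \<le> I / 2\<close>.\<close>
  note this[of "I / (2 * (1 + L))"]
  moreover have "I / (2 * (1 + L)) + I / (2 * (1 + L)) * L = I / 2"
    using L by (simp add: divide_simps) (simp add: algebra_simps)
  ultimately have "I = 0"
    using I0 L by (cases "I = 0") auto
  moreover have "((\<lambda>x. \<bar>u x - U x\<bar>) has_integral I) {0..L}"
    unfolding I_def by (intro integrable_integral integrable_continuous_real continuous_intros uc Uc)
  ultimately have "((\<lambda>x. \<bar>u x - U x\<bar>) has_integral 0) (cbox 0 L)"
    by (simp add: box_real)
  then have eq: "\<bar>u x - U x\<bar> = 0" if "x \<in> {0..L}" for x
    by (rule has_integral_0_cbox_imp_0[rotated 2])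
      (use that L in \<open>auto intro!: continuous_intros uc Uc simp: box_real\<close>)
  then show "u x = integral {0..x} du" if "x \<in> {0..L}" for x
    using that by (simp add: U_def)
  show "u L = 0" using eq[of L] UL L by simp
qed

subsection \<open>Nonexistence\<close>

lemma no_increasing_at_small_values:
  fixes u :: "real \<Rightarrow> real"
  assumes L: "L > 0" and cont: "continuous_on {0..L} u" and u0: "u 0 = 0" and uL: "u L = 0"
    and \<delta>: "\<delta> > 0"
    and inc: "\<And>x y. 0 \<le> x \<Longrightarrow> x < y \<Longrightarrow> y \<le> L \<Longrightarrow> (\<And>t. t \<in> {x..y} \<Longrightarrow> \<bar>u t\<bar> < \<delta>) \<Longrightarrow> u x < u y"
  shows False
proof -
  have near: "\<exists>r>0. \<forall>t\<in>{0..L}. \<bar>t - x\<bar> < r \<longrightarrow> \<bar>u t\<bar> < \<delta>" if x: "x \<in> {0..L}" "u x = 0" for x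
  proof -
    from cont[unfolded continuous_on_iff, rule_format, OF x(1) \<delta>]
    show ?thesis using x(2) by (simp add: dist_real_def)
  qed
  obtain r where r: "r > 0" "\<And>t. t \<in> {0..L} \<Longrightarrow> \<bar>t - L\<bar> < r \<Longrightarrow> \<bar>u t\<bar> < \<delta>"
    using near[of L] L uL by auto
  \<comment> \<open>A point before \<open>L\<close> with \<bar>u\<bar> < \<delta> on all of
    [\<open>e\<close>, \<open>L\<close>], so that \<open>u\<close> is negative at \<open>e\<close>;
    the maximum keeps it in the interval.\<close>
  define e where "e = max 0 (L - r / 2)"
  have e: "0 \<le> e" "e < L" "L - e < r" using r L by (auto simp: e_def)
  have ue: "u e < u L" by (rule inc) (use e in \<open>auto intro!: r\<close>)
  define Z where "Z = {0..e} \<inter> u -` {0}"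
  have "closed Z" unfolding Z_def
    using e by (intro continuous_closed_preimage continuous_on_subset[OF cont]
        closed_singleton closed_atLeastAtMost) auto
  moreover have "bounded Z" unfolding Z_def by (rule bounded_subset[of "{0..e}"]) auto
  ultimately have "compact Z" by (simp add: compact_eq_bounded_closed)
  moreover have "0 \<in> Z" using e u0 by (simp add: Z_def)
  ultimately obtain x where x: "x \<in> Z" "\<And>z. z \<in> Z \<Longrightarrow> z \<le> x"
    using compact_attains_sup[of Z] by blast
  have xe: "0 \<le> x" "x < e" "u x = 0" using x(1) ue uL by (auto simp: Z_def less_le)
  obtain s where s: "s > 0" "\<And>t. t \<in> {0..L} \<Longrightarrow> \<bar>t - x\<bar> < s \<Longrightarrow> \<bar>u t\<bar> < \<delta>"
    using near[of x] xe e by auto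
  \<comment> \<open>A point shortly after the last zero \<open>x\<close> in [0, \<open>e\<close>],
    not beyond \<open>e\<close>; \<open>u\<close> is positive there.\<close>
  define y where "y = min e (x + s / 2)"
  have y: "x < y" "y \<le> e" "y - x < s" using xe s by (auto simp: y_def)
  have "u x < u y" by (rule inc) (use y e xe in \<open>auto intro!: s\<close>)
  moreover have "continuous_on {y..e} u" using y xe e by (intro continuous_on_subset[OF cont]) auto
  ultimately obtain z where "y \<le> z" "z \<le> e" "u z = 0"
    \<comment> \<open>\<open>u\<close> passes from positive at \<open>y\<close> to negative at
      \<open>e\<close>, which yields a zero beyond the largest one.\<close>
    using IVT2'[of u e 0 y] y xe ue uL by auto
  then have "z \<in> Z" using y xe by (simp add: Z_def)
  then show False using x(2)[of z] y \<open>y \<le> z\<close> by simp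
qed

text \<open>The common core of both notions of solution: only test functions in \<open>C1c\<close>
  enter, and these are admissible in either definition.\<close>

lemma weak_identity_C1c_contradiction:
  fixes L p \<alpha> \<beta> :: real and a g :: "real \<Rightarrow> real" and \<phi> :: "real \<Rightarrow> ereal"
  assumes L: "L > 0" and p: "p \<ge> 1" and a: "a \<in> Linf L" and \<alpha>: "0 < \<alpha>" "\<alpha> < \<beta>"
    and ab: "AE x in leb L. \<alpha> \<le> a x \<and> a x \<le> \<beta>" and g: "g \<in> Lp L p"
    and \<phi>: "continuous_on UNIV \<phi>" "\<phi> 0 = \<infinity>" and gM: "AE x in leb L. g x \<ge> - M"
    and u: "u \<in> W1p0 L p" and \<phi>u: "(\<lambda>x. \<phi> (u x)) \<in> Lp_ereal L p"
    and du: "has_weak_derivative L u du"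
    and id: "\<And>\<psi>. \<psi> \<in> C1c L \<Longrightarrow> weak_identity L a g \<phi> u du (deriv \<psi>)"
  shows False
proof -
  note rep = W1p0_eq_integral[OF L p u du]
  define f where "f x = real_of_ereal (\<phi> (u x))" for x
  have fi: "integrable (leb L) f"
    using \<phi>u p unfolding f_def Lp_ereal_def by (blast intro: Lp_integrable)
  have gi: "integrable (leb L) g" by (rule Lp_integrable[OF g p])
  have am: "a \<in> borel_measurable (leb L)" using a by (simp add: Linf_def)
  have adi: "integrable (leb L) (\<lambda>x. a x * du x)"
  proof (rule Bochner_Integration.integrable_bound)
    show "integrable (leb L) (\<lambda>x. \<beta> * du x)" using rep(1) by simp
    show "(\<lambda>x. a x * du x) \<in> borel_measurable (leb L)"
      using am borel_measurable_integrable[OF rep(1)] by (rule borel_measurable_times)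
    show "AE x in leb L. norm (a x * du x) \<le> norm (\<beta> * du x)"
      using ab by eventually_elim (use \<alpha> in \<open>auto simp: abs_mult intro!: mult_right_mono\<close>)
  qed
  \<comment> \<open>The weak identity says that the flux \<open>a x * du x - f x - g x\<close>
    annihilates derivatives of test functions.\<close>
  obtain c where "AE x in leb L. a x * du x - f x - g x = c"
  proof (rule du_Bois_Reymond[OF L])
    show "integrable (leb L) (\<lambda>x. a x * du x - f x - g x)" using adi fi gi by simp
    fix \<psi> assume \<psi>: "\<psi> \<in> C1c L"
    note i = integrable_leb_mult_continuous[OF _ C1c_continuous_deriv[OF \<psi>]]
    have "(LINT x|leb L. (a x * du x - f x - g x) * deriv \<psi> x) =
      (LINT x|leb L. a x * du x * deriv \<psi> x) - (LINT x|leb L. f x * deriv \<psi> x) - (LINT x|leb L. g x * deriv \<psi> x)"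
      using i[OF adi] i[OF fi] i[OF gi] by (simp add: left_diff_distrib)
    then show "(LINT x|leb L. (a x * du x - f x - g x) * deriv \<psi> x) = 0"
      using id[OF \<psi>] by (simp add: weak_identity_def f_def)
  qed
  moreover have "AE x in leb L. \<bar>\<phi> (u x)\<bar> \<noteq> \<infinity>" using \<phi>u by (simp add: Lp_ereal_def)
  moreover note ab gM
  ultimately have slope: "AE x in leb L. \<phi> (u x) > ereal (M - c + 1) \<longrightarrow> du x \<ge> 1 / \<beta>"
  proof eventually_elim
    case (elim x)
    show ?case
    proof
      assume "\<phi> (u x) > ereal (M - c + 1)"
      \<comment> \<open>Finiteness almost everywhere excludes \<phi>(u) = \<infinity>, where
        \<open>real_of_ereal\<close> would return 0.\<close>
      then have "f x > M - c + 1" using elim(2) by (cases "\<phi> (u x)") (auto simp: f_def)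
      \<comment> \<open>The threshold compensates both the lower bound -M of \<open>g\<close> and
        the constant \<open>c\<close>, leaving a margin of 1.\<close>
      then have 1: "a x * du x \<ge> 1" using elim by linarith
      then have "du x > 0" using elim(3) \<alpha>(1) by (smt (verit) mult_nonneg_nonpos)
      then have "a x * du x \<le> \<beta> * du x" using elim(3) by (intro mult_right_mono) auto
      then show "du x \<ge> 1 / \<beta>" using 1 \<alpha> by (simp add: divide_le_eq mult.commute)
    qed
  qed
  \<comment> \<open>As \<phi> is continuous with \<phi>(0) = \<infinity>, it exceeds the threshold
    on a neighbourhood of 0.\<close>
  have "open (\<phi> -` {ereal (M - c + 1)<..})" using \<phi>(1) by (intro open_vimage) auto
  then obtain \<delta> where \<delta>: "\<delta> > 0" "\<And>s. \<bar>s\<bar> < \<delta> \<Longrightarrow> \<phi> s > ereal (M - c + 1)"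
    using \<phi>(2) unfolding open_dist by (force simp: dist_real_def)
  show False
  proof (rule no_increasing_at_small_values[OF L, where u=u and \<delta>=\<delta>])
    show "continuous_on {0..L} u" using u by (simp add: W1p0_def)
    show "u 0 = 0" using rep(2)[of 0] L by simp
    show "u L = 0" "\<delta> > 0" by (fact rep(3) \<delta>(1))+
    fix x y assume xy: "0 \<le> x" "x < y" "y \<le> L" and small: "\<And>t. t \<in> {x..y} \<Longrightarrow> \<bar>u t\<bar> < \<delta>"
    have ai: "du absolutely_integrable_on {0..L}" using rep(1) by (simp add: integrable_leb_iff_closed)
    have aixy: "du absolutely_integrable_on {x<..<y}"
      by (rule set_integrable_subset[OF ai]) (use xy in auto)
    then have ixy: "integrable (lebesgue_on {x<..<y}) du"
      by (simp add: integrable_lebesgue_on_iff)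
    \<comment> \<open>Where \<bar>u\<bar> < \<delta> the slope bound holds; integrating it over
      (\<open>x\<close>, \<open>y\<close>) gives an increase of at least
      \<open>(y - x) / \<beta>\<close>.\<close>
    have "AE t in lebesgue_on {x<..<y}. 1 / \<beta> \<le> du t"
      using slope unfolding AE_restrict_space_iff[of "{x<..<y}" lebesgue, simplified]
        AE_restrict_space_iff[of "{0<..<L}" lebesgue, simplified]
      by eventually_elim (use xy small \<delta>(2) in auto)
    moreover have ic: "integrable (lebesgue_on {x<..<y}) (\<lambda>t. 1 / \<beta>)"
      by (simp add: integrable_lebesgue_on_iff absolutely_integrable_on_const)
    ultimately have "(LINT t|lebesgue_on {x<..<y}. 1 / \<beta>) \<le> (LINT t|lebesgue_on {x<..<y}. du t)"
      using ixy by (intro integral_mono_AE) auto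
    moreover have "(LINT t|lebesgue_on {x<..<y}. 1 / \<beta>) = (y - x) / \<beta>"
      using xy by (simp add: measure_restrict_space)
    ultimately have "(y - x) / \<beta> \<le> integral {x..y} du"
      using \<alpha> lebesgue_integral_eq_integral[OF ixy]
      by (simp add: integral_open_interval_real)
    moreover have "integral {0..x} du + integral {x..y} du = integral {0..y} du"
      using xy absolutely_integrable_on_subinterval[OF ai, of 0 y] set_lebesgue_integral_eq_integral(1)
      by (intro Henstock_Kurzweil_Integration.integral_combine) auto
    moreover have "(y - x) / \<beta> > 0" using xy \<alpha> by simp
    ultimately show "u x < u y" using rep(2)[of x] rep(2)[of y] xy by simp
  qed
qed

theorem theorem3p2:
  fixes L m \<alpha> \<beta> :: real and a g :: "real \<Rightarrow> real" and \<phi> :: "real \<Rightarrow> ereal"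
  assumes "L > 0" and "m \<ge> 1"
    and "a \<in> Linf L" and "0 < \<alpha>" and "\<alpha> < \<beta>"
    and "AE x in leb L. \<alpha> \<le> a x \<and> a x \<le> \<beta>"
    and "g \<in> Lp L m"
    and "continuous_on UNIV \<phi>"
    and "\<And>s. \<phi> s \<noteq> -\<infinity>"
    and "\<And>s. s \<noteq> 0 \<Longrightarrow> \<phi> s < \<infinity>"
    and "\<phi> 0 = \<infinity>"
    and "\<exists>M>0. AE x in leb L. g x \<ge> - M"
  shows "(m = 1 \<longrightarrow> \<not> (\<exists>u. weak_solution_1 L a g \<phi> u)) \<and>
         (m > 1 \<longrightarrow> \<not> (\<exists>u. weak_solution_m L m a g \<phi> u))"
proof -
  obtain M where M: "AE x in leb L. g x \<ge> - M" using assms(12) by blast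
  have contra: False
    if "u \<in> W1p0 L m" "(\<lambda>x. \<phi> (u x)) \<in> Lp_ereal L m" "has_weak_derivative L u du"
      "\<And>\<psi>. \<psi> \<in> C1c L \<Longrightarrow> weak_identity L a g \<phi> u du (deriv \<psi>)" for u du
    by (rule weak_identity_C1c_contradiction[OF assms(1-8,11) M that])
  show ?thesis
  proof (intro conjI impI notI)
    assume m: "m = 1" and "\<exists>u. weak_solution_1 L a g \<phi> u"
    then obtain u du where u: "u \<in> W1p0 L m" "(\<lambda>x. \<phi> (u x)) \<in> Lp_ereal L m" "has_weak_derivative L u du"
      and id: "\<And>z dz. \<lbrakk>\<exists>C. C-lipschitz_on {0..L} z; z 0 = 0; z L = 0; has_weak_derivative L z dz\<rbrakk>
        \<Longrightarrow> weak_identity L a g \<phi> u du dz"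
      unfolding weak_solution_1_def by blast
    show False
    proof (rule contra[OF u id])
      fix \<psi> assume \<psi>: "\<psi> \<in> C1c L"
      show "\<exists>C. C-lipschitz_on {0..L} \<psi>" by (rule C1c_lipschitz[OF \<psi>])
      show "\<psi> 0 = 0" "\<psi> L = 0" using C1c_outside[OF \<psi>] by auto
      show "has_weak_derivative L \<psi> (deriv \<psi>)" by (rule C1c_weak_derivative[OF assms(1) \<psi>])
    qed
  next
    assume m: "m > 1" and "\<exists>u. weak_solution_m L m a g \<phi> u"
    then obtain u du where u: "u \<in> W1p0 L m" "(\<lambda>x. \<phi> (u x)) \<in> Lp_ereal L m" "has_weak_derivative L u du"
      and id: "\<And>z dz. \<lbrakk>z \<in> W1p0 L (m / (m - 1)); has_weak_derivative L z dz\<rbrakk>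
        \<Longrightarrow> weak_identity L a g \<phi> u du dz"
      unfolding weak_solution_m_def by blast
    show False
    proof (rule contra[OF u id])
      fix \<psi> assume \<psi>: "\<psi> \<in> C1c L"
      \<comment> \<open>The conjugate exponent is positive because \<open>m > 1\<close>.\<close>
      show "\<psi> \<in> W1p0 L (m / (m - 1))" using m by (intro C1c_in_W1p0[OF assms(1) _ \<psi>]) simp
      show "has_weak_derivative L \<psi> (deriv \<psi>)" by (rule C1c_weak_derivative[OF assms(1) \<psi>])
    qed
  qed
qed

end
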